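(* Let $(x_1,x_2,x_3)\in\mathbb{R}^3$ with $(x_1,x_2,x_3)\ne(0,0,0)$. Then: (i) $(x_1+x_2+x_3)^4>8(x_1^3x_2+x_1x_3^3+x_2^3x_3)+x_1x_2x_3(19x_1+17x_2+15x_3)$; (iii) $(x_1+x_2+x_3)^4>8(x_1^3x_2+x_1x_3^3+x_2^3x_3)+x_1x_2x_3(19x_1+16x_2+15x_3)$; (iv) $(x_1+x_2+x_3)^4>8(x_1^3x_2+x_1x_3^3+x_2^3x_3)+x_1x_2x_3(15x_1+14x_2+14x_3)$; (v) $(x_1+x_2+x_3)^4>8(x_1^3x_2+x_1x_3^3+x_2^3x_3)+x_1x_2x_3(15x_1+16x_2+14x_3)$; (vi) $(x_1+x_2+x_3)^4>8(x_1^3x_2+x_1x_3^3+x_2^3x_3)+x_1x_2x_3(17x_1+15x_2+18x_3)$. Furthermore, all these strict inequalities still hold if, in each of them, the expression $x_1^3x_2+x_1x_3^3+x_2^3x_3$ is replaced by $x_1x_2^3+x_1^3x_3+x_2x_3^3$ (the remaining terms being unchanged). *)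

theory Defs
  imports Complex_Main
begin

end

theory Submission
  imports Defs
begin

text \<open>
  Put \<^term>\<open>S = x^3 * y + y^3 * z + z^3 * x\<close> and
  \<^term>\<open>F = (x + y + z)^4 - 8 * S - x * y * z * (a * x + b * y + c * z)\<close>.  A nonnegative ternary
  quartic is a sum of squares of quadratic forms, so the problem is to find a positive definite
  Gram matrix for \<open>F\<close> in the monomials \<open>x\<^sup>2, y\<^sup>2, z\<^sup>2, yz, zx, xy\<close>.  Such matrices form a
  six-parameter family: the coefficient of \<open>x\<^sup>2y\<^sup>2\<close> can be split between \<open>x\<^sup>2 \<cdot> y\<^sup>2\<close> and \<open>(xy)\<^sup>2\<close>, and that
  of \<open>x\<^sup>2yz\<close> between \<open>x\<^sup>2 \<cdot> yz\<close> and \<open>zx \<cdot> xy\<close>, in each case together with the two cyclic analogues.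

  A single matrix with unit diagonal and off-diagonal entries \<open>-7/15\<close> serves in all cases as the
  block of the pure squares; up to a factor it is the form
  \<open>7 ((u - v)\<^sup>2 + (v - w)\<^sup>2 + (w - u)\<^sup>2) + (u\<^sup>2 + v\<^sup>2 + w\<^sup>2)\<close>.  It is nearly singular along \<open>(1, 1, 1)\<close>, and
  this is what leaves enough weight on the products to compensate the antisymmetric part
  \<open>-4 (x\<^sup>3y - xy\<^sup>3 + \<dots>)\<close> of \<open>F\<close>.  The other three parameters \<open>s, t, r\<close> say how the terms
  \<open>x\<^sup>2yz\<close>, \<open>xy\<^sup>2z\<close>, \<open>xyz\<^sup>2\<close> are split.  Eliminating the pure squares leaves a ternary quadratic form in
  \<open>yz, zx, xy\<close> (\<open>gram_decomposition\<close>), and \<open>F\<close> is positive as soon as this form is positive definite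
  (\<open>cyclic_quartic_pos\<close>), which three leading minors decide (\<open>ternary_form_pos\<close>).

  Each inequality is then a choice of \<open>(s, t, r)\<close>.  Up to cyclic shifts two choices suffice:
  \<open>(0, 0, 5)\<close> for the coefficients with \<open>a + b + c \<ge> 50\<close>, and \<open>(4, 4, 6)\<close> for those with
  \<open>a + b + c \<le> 45\<close>, among which are the inequalities closest to failing.
  The variants with the mirrored cyclic sum follow by exchanging the second and third variables,
  which turns that sum into \<open>S\<close> and exchanges \<open>b\<close> with \<open>c\<close>.
\<close>

text \<open>
  Sylvester's criterion for the symmetric matrix with diagonal \<open>d1, d2, d3\<close> and off-diagonal
  entries \<open>A, B, C\<close> at the positions \<open>(2,3)\<close>, \<open>(1,3)\<close>, \<open>(1,2)\<close>, obtained by completing squares twice.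
\<close>
lemma ternary_form_pos:
  fixes d1 d2 d3 A B C p q r :: real
  assumes d1: "d1 > 0"
    and minor: "d1 * d2 - C^2 > 0"
    and det: "d1 * d2 * d3 + 2 * A * B * C - d1 * A^2 - d2 * B^2 - d3 * C^2 > 0"
    and nz: "(p, q, r) \<noteq> (0, 0, 0)"
  shows "d1 * p^2 + d2 * q^2 + d3 * r^2 + 2 * (A * q * r + B * r * p + C * p * q) > 0"
proof -
  define m where "m = d1 * d2 - C^2"
  define e where "e = d1 * d2 * d3 + 2 * A * B * C - d1 * A^2 - d2 * B^2 - d3 * C^2"
  define Q where "Q = d1 * p^2 + d2 * q^2 + d3 * r^2 + 2 * (A * q * r + B * r * p + C * p * q)"
  define f where "f = d1 * p + C * q + B * r"
  define g where "g = m * q + (d1 * A - B * C) * r"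
  have pos: "m > 0" "e > 0" using minor det by (auto simp: m_def e_def)
  have squares: "d1 * m * Q = m * f^2 + (g^2 + d1 * e * r^2)"
    unfolding Q_def f_def g_def m_def e_def by algebra
  have "m * f^2 + (g^2 + d1 * e * r^2) > 0"
  proof (cases "r = 0 \<and> q = 0")
    case True
    with nz have "f \<noteq> 0" using d1 by (auto simp: f_def)
    then have "m * f^2 > 0" using pos by simp
    moreover have "g^2 + d1 * e * r^2 \<ge> 0" using d1 pos by simp
    ultimately show ?thesis by linarith
  next
    case False
    then have "g \<noteq> 0 \<or> r \<noteq> 0" using pos by (auto simp: g_def)
    then have "g^2 + d1 * e * r^2 > 0"
      using d1 pos by (auto intro: add_pos_nonneg add_nonneg_pos)
    moreover have "m * f^2 \<ge> 0" using pos by simp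
    ultimately show ?thesis by linarith
  qed
  then have "(d1 * m) * Q > 0" using squares by simp
  then have "Q > 0" using d1 pos by (blast intro: zero_less_mult_pos mult_pos_pos)
  then show ?thesis by (simp add: Q_def)
qed

text \<open>
  The block \<open>E\<close> of the pure squares has inverse \<open>(15/22) (I + 7 J)\<close> with \<open>J\<close> the all-ones matrix, since
  \<open>1 + 7/15 = 22/15\<close> and \<open>1 - 2 \<cdot> 7/15 = 1/15\<close>.  The block \<open>M\<close> coupling squares with products has
  diagonal \<open>s/15, t/15, r/15\<close> and off-diagonal entries \<open>2\<close> and \<open>-2\<close>, dictated by the coefficients
  \<open>-4\<close> of \<open>x\<^sup>3y\<close> and \<open>4\<close> of \<open>xy\<^sup>3\<close> in \<open>F\<close>.  Completing squares adds \<open>E\<^sup>-\<^sup>1 M\<close> applied to the products to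
  \<open>(x\<^sup>2, y\<^sup>2, z\<^sup>2)\<close>; this is the triple \<open>(w1, w2, w3)\<close>, scaled by \<open>22\<close> to have integer coefficients.
  The remaining form in the products is the Schur complement, and \<open>7260 = 15 \<cdot> 22\<^sup>2\<close>.
\<close>
lemma gram_decomposition:
  fixes x y z a b c s t r :: real
  defines "l \<equiv> 7 * (s * (y * z) + t * (z * x) + r * (x * y))"
  defines "w1 \<equiv> 22 * x^2 + l + s * (y * z) + 30 * (z * x - x * y)"
    and "w2 \<equiv> 22 * y^2 + l + t * (z * x) + 30 * (x * y - y * z)"
    and "w3 \<equiv> 22 * z^2 + l + r * (x * y) + 30 * (y * z - z * x)"
  shows "7260 * ((x + y + z)^4 - 8 * (x^3 * y + y^3 * z + z^3 * x) - x * y * z * (a * x + b * y + c * z))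
    = 7 * ((w1 - w2)^2 + (w2 - w3)^2 + (w3 - w1)^2) + (w1^2 + w2^2 + w3^2)
      + 22 * ((488 - 8 * s^2) * (y * z)^2 + (488 - 8 * t^2) * (z * x)^2 + (488 - 8 * r^2) * (x * y)^2
        + 2 * ((2880 - 165 * a - 22 * s - 30 * (t - r) - 7 * t * r) * (z * x) * (x * y)
             + (2880 - 165 * b - 22 * t - 30 * (r - s) - 7 * r * s) * (x * y) * (y * z)
             + (2880 - 165 * c - 22 * r - 30 * (s - t) - 7 * s * t) * (y * z) * (z * x)))"
  unfolding w1_def w2_def w3_def l_def by algebra

text \<open>
  Positive definiteness of the Schur complement gives strict positivity unless all three products
  vanish, and in that case the quartic is the fourth power of a single variable.
\<close>
lemma cyclic_quartic_pos:
  fixes x y z a b c s t r :: real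
  defines "d1 \<equiv> 488 - 8 * s^2" and "d2 \<equiv> 488 - 8 * t^2" and "d3 \<equiv> 488 - 8 * r^2"
    and "A \<equiv> 2880 - 165 * a - 22 * s - 30 * (t - r) - 7 * t * r"
    and "B \<equiv> 2880 - 165 * b - 22 * t - 30 * (r - s) - 7 * r * s"
    and "C \<equiv> 2880 - 165 * c - 22 * r - 30 * (s - t) - 7 * s * t"
  assumes nz: "(x, y, z) \<noteq> (0, 0, 0)"
    and minors: "d1 > 0" "d1 * d2 - C^2 > 0"
      "d1 * d2 * d3 + 2 * A * B * C - d1 * A^2 - d2 * B^2 - d3 * C^2 > 0"
  shows "(x + y + z)^4 > 8 * (x^3 * y + y^3 * z + z^3 * x) + x * y * z * (a * x + b * y + c * z)"
proof (cases "(y * z, z * x, x * y) = (0, 0, 0)")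
  case True
  with nz consider "x \<noteq> 0" "y = 0" "z = 0" | "x = 0" "y \<noteq> 0" "z = 0" | "x = 0" "y = 0" "z \<noteq> 0"
    by auto
  then show ?thesis by cases simp_all
next
  case False
  define Q where "Q = d1 * (y * z)^2 + d2 * (z * x)^2 + d3 * (x * y)^2
    + 2 * (A * (z * x) * (x * y) + B * (x * y) * (y * z) + C * (y * z) * (z * x))"
  have "Q > 0"
    unfolding Q_def by (rule ternary_form_pos[OF minors False])
  then have "22 * Q > 0" by simp
  then have "7260 * ((x + y + z)^4 - 8 * (x^3 * y + y^3 * z + z^3 * x)
      - x * y * z * (a * x + b * y + c * z)) > 0"
    unfolding gram_decomposition[of x y z a b c s t r] Q_def d1_def d2_def d3_def A_def B_def C_def
    by (rule add_nonneg_pos[rotated]) simp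
  then show ?thesis by simp
qed

theorem corollary4p8:
  fixes x1 x2 x3 :: real
  assumes "(x1, x2, x3) \<noteq> (0, 0, 0)"
  shows
    "(x1 + x2 + x3)^4 > 8 * (x1^3 * x2 + x1 * x3^3 + x2^3 * x3) + x1 * x2 * x3 * (19 * x1 + 17 * x2 + 15 * x3) \<and>
     (x1 + x2 + x3)^4 > 8 * (x1^3 * x2 + x1 * x3^3 + x2^3 * x3) + x1 * x2 * x3 * (19 * x1 + 16 * x2 + 15 * x3) \<and>
     (x1 + x2 + x3)^4 > 8 * (x1^3 * x2 + x1 * x3^3 + x2^3 * x3) + x1 * x2 * x3 * (15 * x1 + 14 * x2 + 14 * x3) \<and>
     (x1 + x2 + x3)^4 > 8 * (x1^3 * x2 + x1 * x3^3 + x2^3 * x3) + x1 * x2 * x3 * (15 * x1 + 16 * x2 + 14 * x3) \<and>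
     (x1 + x2 + x3)^4 > 8 * (x1^3 * x2 + x1 * x3^3 + x2^3 * x3) + x1 * x2 * x3 * (17 * x1 + 15 * x2 + 18 * x3) \<and>
     (x1 + x2 + x3)^4 > 8 * (x1 * x2^3 + x1^3 * x3 + x2 * x3^3) + x1 * x2 * x3 * (19 * x1 + 17 * x2 + 15 * x3) \<and>
     (x1 + x2 + x3)^4 > 8 * (x1 * x2^3 + x1^3 * x3 + x2 * x3^3) + x1 * x2 * x3 * (19 * x1 + 16 * x2 + 15 * x3) \<and>
     (x1 + x2 + x3)^4 > 8 * (x1 * x2^3 + x1^3 * x3 + x2 * x3^3) + x1 * x2 * x3 * (15 * x1 + 14 * x2 + 14 * x3) \<and>
     (x1 + x2 + x3)^4 > 8 * (x1 * x2^3 + x1^3 * x3 + x2 * x3^3) + x1 * x2 * x3 * (15 * x1 + 16 * x2 + 14 * x3) \<and>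
     (x1 + x2 + x3)^4 > 8 * (x1 * x2^3 + x1^3 * x3 + x2 * x3^3) + x1 * x2 * x3 * (17 * x1 + 15 * x2 + 18 * x3)"
proof -
  have swapped: "(x1, x3, x2) \<noteq> (0, 0, 0)" using assms by auto
  show ?thesis
    using cyclic_quartic_pos[OF assms, where a = 19 and b = 17 and c = 15 and s = 0 and t = 0 and r = 5]
      cyclic_quartic_pos[OF assms, where a = 19 and b = 16 and c = 15 and s = 0 and t = 0 and r = 5]
      cyclic_quartic_pos[OF assms, where a = 15 and b = 14 and c = 14 and s = 4 and t = 4 and r = 6]
      cyclic_quartic_pos[OF assms, where a = 15 and b = 16 and c = 14 and s = 6 and t = 4 and r = 4]
      cyclic_quartic_pos[OF assms, where a = 17 and b = 15 and c = 18 and s = 0 and t = 5 and r = 0]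
      cyclic_quartic_pos[OF swapped, where a = 19 and b = 15 and c = 17 and s = 0 and t = 0 and r = 5]
      cyclic_quartic_pos[OF swapped, where a = 19 and b = 15 and c = 16 and s = 0 and t = 0 and r = 5]
      cyclic_quartic_pos[OF swapped, where a = 15 and b = 14 and c = 14 and s = 4 and t = 4 and r = 6]
      cyclic_quartic_pos[OF swapped, where a = 15 and b = 14 and c = 16 and s = 4 and t = 6 and r = 4]
      cyclic_quartic_pos[OF swapped, where a = 17 and b = 18 and c = 15 and s = 5 and t = 0 and r = 0]
    by (simp add: algebra_simps)
qed

end
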